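(* Let $s'\ge 1$ be an integer, let $c$ be an edge-colouring of a clique using exactly $s'$ colours, and let $s$ be an integer with $s>s'$ (the colours used by $c$ being elements of $[s]$). Then: (i) for every positive integer $n$, $h_{s+1}(n,c)\ge h_s(n,c)$; (ii) for every real $\xi>0$ there is $n_0$ (depending on $\xi, c, s$) such that for all integers $n\ge n_0$, $h_{s+1}(n,c)\le \bigl(h_s(n,c)\bigr)^{1+\xi}$. In particular, $c$ has the EH-property for $s$ colours if and only if $c$ has the EH-property for $s+1$ colours.
   Context: A clique of size $n$ is a complete graph $K_n$ on $n$ vertices; write $[m]=\{1,\dots,m\}$. For a positive integer $s$, an $s$-edge-colouring of $K_n$ on vertex set $[n]$ is any map $\binom{[n]}{2}\to[s]$ (not necessarily surjective). Let $c''$ be an $s$-edge-colouring of $K_n$ on vertex set $V$, and let $c$ be an edge-colouring of $K_k$ (on vertex set $[k]$) with colours in $[s]$. A copy of $c$ in $c''$ is a set $U\subseteq V$ with $|U|=k$ for which there is a bijection $\phi:U\to[k]$ such that $c''(xy)=c(\phi(x)\phi(y))$ for all distinct $x,y\in U$ (colours are preserved exactly). The colouring $c''$ is $c$-free if there is no copy of $c$ in $c''$. A homogeneous set in an $s$-edge-colouring $c''$ of $K_n$ is a set $X$ of vertices such that $|\{c''(xy): x,y\in X,\ x\ne y\}|<s$, i.e. at least one colour of $[s]$ does not appear on the edges inside $X$. The size of a largest homogeneous set in $c''$ is denoted $h_s(c'')$. Define $$h_s(n,c)=\min\{h_s(c'') : c'' \text{ is a } c\text{-free } s\text{-edge-colouring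 of } K_n\}.$$ The colouring $c$ has the EH-property for $s$ colours if there are constants $\epsilon>0$ and $C>0$ (depending only on $c$ and $s$) such that $h_s(n,c)\ge C n^{\epsilon}$ for all $n$. *)

theory Defs
  imports Complex_Main "HOL-Library.FuncSet" "HOL-Library.Ramsey"
begin

(* Edges of the clique on V are the elements of nsets V 2, so the colour of the edge xy under f
   is f {x, y}. Values of f outside nsets V 2 are unconstrained, and nothing below depends on them. *)
definition edge_colourings :: "nat \<Rightarrow> 'a set \<Rightarrow> ('a set \<Rightarrow> nat) set" where
  "edge_colourings s V = (nsets V 2 \<rightarrow> {1..s})"

definition is_copy :: "nat \<Rightarrow> (nat set \<Rightarrow> nat) \<Rightarrow> 'a set \<Rightarrow> ('a set \<Rightarrow> nat) \<Rightarrow> 'a set \<Rightarrow> bool" where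
  "is_copy k c V f U \<longleftrightarrow> U \<subseteq> V \<and> card U = k \<and>
     (\<exists>\<phi>. bij_betw \<phi> U {1..k} \<and>
        (\<forall>x\<in>U. \<forall>y\<in>U. x \<noteq> y \<longrightarrow> f {x, y} = c {\<phi> x, \<phi> y}))"

definition copy_free :: "nat \<Rightarrow> (nat set \<Rightarrow> nat) \<Rightarrow> 'a set \<Rightarrow> ('a set \<Rightarrow> nat) \<Rightarrow> bool" where
  "copy_free k c V f \<longleftrightarrow> \<not> (\<exists>U. is_copy k c V f U)"

definition homogeneous :: "nat \<Rightarrow> 'a set \<Rightarrow> ('a set \<Rightarrow> nat) \<Rightarrow> 'a set \<Rightarrow> bool" where
  "homogeneous s V f X \<longleftrightarrow> X \<subseteq> V \<and> card {f {x, y} | x y. x \<in> X \<and> y \<in> X \<and> x \<noteq> y} < s"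

definition max_homogeneous :: "nat \<Rightarrow> 'a set \<Rightarrow> ('a set \<Rightarrow> nat) \<Rightarrow> nat" where
  "max_homogeneous s V f = Max (card ` {X. homogeneous s V f X})"

(* The minimum ranges over a nonempty set as soon as k >= 2 and some colour of {1..s} is not used
   by c: colour every edge with that colour. See min_homogeneous_wf. *)
definition min_homogeneous :: "nat \<Rightarrow> nat \<Rightarrow> nat \<Rightarrow> (nat set \<Rightarrow> nat) \<Rightarrow> nat" where
  "min_homogeneous s n k c =
     Min (max_homogeneous s {1..n} ` {f \<in> edge_colourings s {1..n}. copy_free k c {1..n} f})"

definition EH_property :: "nat \<Rightarrow> nat \<Rightarrow> (nat set \<Rightarrow> nat) \<Rightarrow> bool" where
  "EH_property s k c \<longleftrightarrow>
     (\<exists>\<epsilon>::real>0. \<exists>C::real>0. \<forall>n\<ge>1. C * real n powr \<epsilon> \<le> real (min_homogeneous s n k c))"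

lemma max_homogeneous_wf:
  assumes "finite V" "s \<ge> 1"
  shows "finite (card ` {X. homogeneous s V f X})" "card ` {X. homogeneous s V f X} \<noteq> {}"
proof -
  have "{X. homogeneous s V f X} \<subseteq> Pow V"
    by (auto simp: homogeneous_def)
  then show "finite (card ` {X. homogeneous s V f X})"
    using assms(1) by (meson finite_Pow_iff finite_imageI finite_subset)
  have "homogeneous s V f {}"
    using assms(2) by (simp add: homogeneous_def)
  then show "card ` {X. homogeneous s V f X} \<noteq> {}"
    by blast
qed

lemma max_homogeneous_le:
  assumes "finite V" "s \<ge> 1"
  shows "max_homogeneous s V f \<le> card V"
  unfolding max_homogeneous_def
  by (subst Max_le_iff[OF max_homogeneous_wf[OF assms]])
     (auto simp: homogeneous_def intro: card_mono assms(1))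

lemma min_homogeneous_wf:
  fixes c :: "nat set \<Rightarrow> nat" and k n s :: nat
  assumes used: "card (c ` nsets {1..k} 2) < s" and "card (c ` nsets {1..k} 2) \<ge> 1"
  defines "M \<equiv> max_homogeneous s {1..n} ` {f \<in> edge_colourings s {1..n}. copy_free k c {1..n} f}"
  shows "finite M" "M \<noteq> {}"
proof -
  have "M \<subseteq> {..n}"
    using max_homogeneous_le[of "{1..n}" s] used by (auto simp: M_def)
  then show "finite M"
    by (rule finite_subset) simp
  have "finite (c ` nsets {1..k} 2)"
    by (intro finite_imageI finite_imp_finite_nsets) simp
  then obtain a where a: "a \<in> {1..s}" "a \<notin> c ` nsets {1..k} 2"
    using used card_mono[of "c ` nsets {1..k} 2" "{1..s}"] by fastforce
  have "nsets {1..k} 2 \<noteq> {}"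
    using assms(2) by force
  then have k: "k \<ge> 2"
    by (simp add: nsets_eq_empty_iff)
  have "copy_free k c {1..n} (\<lambda>_. a)"
    unfolding copy_free_def is_copy_def
  proof clarify
    fix U and \<phi> :: "nat \<Rightarrow> nat"
    assume bij: "bij_betw \<phi> U {1..card U}" and eq: "\<forall>x\<in>U. \<forall>y\<in>U. x \<noteq> y \<longrightarrow> a = c {\<phi> x, \<phi> y}"
      and kU: "k = card U"
    have "\<phi> ` U = {1..k}"
      using bij kU by (simp add: bij_betw_def)
    with k have "1 \<in> \<phi> ` U" "2 \<in> \<phi> ` U"
      by auto
    then obtain x y where "x \<in> U" "\<phi> x = 1" "y \<in> U" "\<phi> y = 2"
      by (metis imageE)
    then have "a = c {1, 2}"
      using eq by force
    moreover have "{1, 2} \<in> nsets {1..k} 2"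
      using k by (auto simp: nsets_def)
    ultimately show False
      using a(2) by blast
  qed
  moreover have "(\<lambda>_. a) \<in> edge_colourings s {1..n}"
    using a(1) by (simp add: edge_colourings_def)
  ultimately show "M \<noteq> {}"
    unfolding M_def by blast
qed

end

theory Submission
  imports Defs "HOL-Library.Disjoint_Sets" "HOL-Real_Asymp.Real_Asymp"
begin

text \<open>
  Let \<open>a \<le> s\<close> be a colour that \<open>c\<close> does not use. Merging colour \<open>s + 1\<close> into \<open>a\<close> keeps a colouring
  \<open>c\<close>-free, and every homogeneous set of the merged colouring is homogeneous in the original one; this
  gives (i).

  For (ii), take an optimal \<open>c\<close>-free \<open>s\<close>-colouring, with largest homogeneous set of size \<open>h\<close>, and give
  each \<open>a\<close>-edge colour \<open>a\<close> or \<open>s + 1\<close> at random. A set of more than \<open>h\<close> vertices contains an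
  \<open>a\<close>-edge, so by Turan a set of \<open>4 h p\<close> vertices contains at least \<open>4 h p\<^sup>2\<close> of them. If
  \<open>2 n \<le> 2 ^ p\<close>, the union bound therefore excludes that some such set loses \<open>a\<close> or \<open>s + 1\<close>, and
  \<open>h\<^sub>s\<^sub>+\<^sub>1(n, c) \<le> 4 h p\<close>. The factor \<open>4 p = O(log n)\<close> is absorbed into \<open>h\<close> to the power \<open>\<xi>\<close> because
  \<open>h\<close> grows faster than every power of \<open>log n\<close>, by the argument of Erdos and Hajnal: a \<open>c\<close>-free
  colouring has two large disjoint sets between which some colour of \<open>c\<close> is sparse, and
  recursion into both sets builds a vertex set on which the product over all colours \<open>b\<close> of
  the sizes of the largest \<open>b\<close>-free subsets is large.
\<close>

section \<open>Missing colours and homogeneous sets\<close>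

text \<open>\<open>homogeneous\<close> only counts the colours inside a set; the counting and
  merging arguments below need to know which colour is missing.\<close>

definition avoids :: "('a set \<Rightarrow> nat) \<Rightarrow> nat \<Rightarrow> 'a set \<Rightarrow> bool" where
  "avoids f b X \<longleftrightarrow> (\<forall>x\<in>X. \<forall>y\<in>X. x \<noteq> y \<longrightarrow> f {x, y} \<noteq> b)"

lemma pair_in_nsets [simp]: "x \<noteq> y \<Longrightarrow> x \<in> V \<Longrightarrow> y \<in> V \<Longrightarrow> {x, y} \<in> nsets V 2"
  by (simp add: nsets_def)

lemma edge_colouring_pair:
  "f \<in> edge_colourings s V \<Longrightarrow> x \<in> V \<Longrightarrow> y \<in> V \<Longrightarrow> x \<noteq> y \<Longrightarrow> f {x, y} \<in> {1..s}"
  unfolding edge_colourings_def by (erule funcset_mem) simp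

text \<open>The colours inside \<open>X\<close> form a subset of \<open>{1..s}\<close>, and such a
  subset has fewer than \<open>s\<close> elements exactly when it misses one.\<close>

lemma homogeneous_iff_avoids:
  assumes "f \<in> edge_colourings s V"
  shows "homogeneous s V f X \<longleftrightarrow> X \<subseteq> V \<and> (\<exists>b\<in>{1..s}. avoids f b X)"
proof (cases "X \<subseteq> V")
  case True
  define K where "K = {f {x, y} | x y. x \<in> X \<and> y \<in> X \<and> x \<noteq> y}"
  have sub: "K \<subseteq> {1..s}"
    using edge_colouring_pair[OF assms] True unfolding K_def by blast
  have "card K < s \<longleftrightarrow> K \<noteq> {1..s}"
  proof
    assume "K \<noteq> {1..s}"
    with sub have "K \<subset> {1..s}" by blast
    then show "card K < s"
      using psubset_card_mono[of "{1..s}" K] by simp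
  qed auto
  also have "\<dots> \<longleftrightarrow> (\<exists>b\<in>{1..s}. b \<notin> K)"
    using sub by blast
  also have "\<dots> \<longleftrightarrow> (\<exists>b\<in>{1..s}. avoids f b X)"
    unfolding avoids_def K_def mem_Collect_eq by metis
  finally show ?thesis
    using True unfolding homogeneous_def K_def by simp
qed (simp add: homogeneous_def)

lemma card_le_max_homogeneous:
  assumes "finite V" "homogeneous s V f X"
  shows "card X \<le> max_homogeneous s V f"
proof -
  have "s \<ge> 1"
    using assms(2) by (simp add: homogeneous_def)
  then show ?thesis
    unfolding max_homogeneous_def
    using max_homogeneous_wf(1)[OF assms(1)] assms(2) by (intro Max_ge) auto
qed

lemma max_homogeneous_leI:
  assumes "finite V" "s \<ge> 1" "\<And>X. homogeneous s V f X \<Longrightarrow> card X \<le> m"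
  shows "max_homogeneous s V f \<le> m"
  unfolding max_homogeneous_def
  by (subst Max_le_iff[OF max_homogeneous_wf[OF assms(1,2)]]) (auto intro: assms(3))

lemma min_homogeneous_le:
  assumes "card (c ` nsets {1..k} 2) < s" "card (c ` nsets {1..k} 2) \<ge> 1"
    and "f \<in> edge_colourings s {1..n}" "copy_free k c {1..n} f"
  shows "min_homogeneous s n k c \<le> max_homogeneous s {1..n} f"
  unfolding min_homogeneous_def
  using min_homogeneous_wf(1)[OF assms(1,2)] assms(3,4) by (intro Min_le) auto

lemma min_homogeneous_attained:
  assumes "card (c ` nsets {1..k} 2) < s" "card (c ` nsets {1..k} 2) \<ge> 1"
  obtains f where "f \<in> edge_colourings s {1..n}" "copy_free k c {1..n} f"
    and "min_homogeneous s n k c = max_homogeneous s {1..n} f"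
  using Min_in[OF min_homogeneous_wf[OF assms, of n]] that
  unfolding min_homogeneous_def by blast

section \<open>Recolouring and monotonicity in the number of colours\<close>

lemma copy_free_recolour:
  assumes "copy_free k c V f"
    and "\<And>x y. x \<in> V \<Longrightarrow> y \<in> V \<Longrightarrow> x \<noteq> y \<Longrightarrow> g {x, y} \<in> c ` nsets {1..k} 2 \<Longrightarrow> f {x, y} = g {x, y}"
  shows "copy_free k c V g"
  unfolding copy_free_def
proof
  assume "\<exists>U. is_copy k c V g U"
  then obtain U \<phi> where U: "U \<subseteq> V" "card U = k" and bij: "bij_betw \<phi> U {1..k}"
    and eq: "\<And>x y. x \<in> U \<Longrightarrow> y \<in> U \<Longrightarrow> x \<noteq> y \<Longrightarrow> g {x, y} = c {\<phi> x, \<phi> y}"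
    unfolding is_copy_def by blast
  have "f {x, y} = c {\<phi> x, \<phi> y}" if "x \<in> U" "y \<in> U" "x \<noteq> y" for x y
  proof -
    have "{\<phi> x, \<phi> y} \<in> nsets {1..k} 2"
      using that bij by (intro pair_in_nsets) (auto simp: bij_betw_def inj_on_def)
    then show ?thesis
      using assms(2)[of x y] eq[OF that] U that by auto
  qed
  then have "is_copy k c V f U"
    unfolding is_copy_def using U bij by blast
  then show False
    using assms(1) by (auto simp: copy_free_def)
qed

lemma unused_colour:
  assumes "card (c ` nsets {1..k::nat} 2) < s"
  obtains a :: nat where "a \<in> {1..s}" "a \<notin> c ` nsets {1..k} 2"
proof -
  have "finite (c ` nsets {1..k} 2)"
    by (intro finite_imageI finite_imp_finite_nsets) simp
  then have "\<not> {1..s} \<subseteq> c ` nsets {1..k} 2"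
    using assms card_mono[of "c ` nsets {1..k} 2" "{1..s}"] by fastforce
  then show ?thesis
    using that by blast
qed

lemma min_homogeneous_Suc_ge:
  assumes "c \<in> edge_colourings s {1..k}"
    and used: "card (c ` nsets {1..k} 2) < s" "card (c ` nsets {1..k} 2) \<ge> 1"
  shows "min_homogeneous s n k c \<le> min_homogeneous (s + 1) n k c"
proof -
  obtain a where a: "a \<in> {1..s}" "a \<notin> c ` nsets {1..k} 2"
    using unused_colour[OF used(1)] .
  have used': "card (c ` nsets {1..k} 2) < s + 1"
    using used by simp
  obtain f where f: "f \<in> edge_colourings (s + 1) {1..n}" "copy_free k c {1..n} f"
    and fmin: "min_homogeneous (s + 1) n k c = max_homogeneous (s + 1) {1..n} f"
    using min_homogeneous_attained[OF used' used(2)] .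
  define g where "g = (\<lambda>e. if f e = s + 1 then a else f e)"
  have g: "g \<in> edge_colourings s {1..n}"
    using f(1) a(1) by (force simp: edge_colourings_def g_def Pi_iff)
  have "copy_free k c {1..n} g"
    using f(2) by (rule copy_free_recolour) (use a(2) in \<open>auto simp: g_def split: if_splits\<close>)
  then have "min_homogeneous s n k c \<le> max_homogeneous s {1..n} g"
    using used g by (intro min_homogeneous_le)
  also have "\<dots> \<le> max_homogeneous (s + 1) {1..n} f"
  proof (rule max_homogeneous_leI)
    fix X assume "homogeneous s {1..n} g X"
    then obtain b where b: "X \<subseteq> {1..n}" "b \<in> {1..s}" "avoids g b X"
      using homogeneous_iff_avoids[OF g] by blast
    \<comment> \<open>As \<open>b \<le> s\<close>, an edge with \<open>f\<close>-colour
      \<open>b\<close> keeps it under \<open>g\<close>; this includes \<open>b = a\<close>.\<close>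
    then have "avoids f b X"
      by (fastforce simp: avoids_def g_def)
    then have "homogeneous (s + 1) {1..n} f X"
      using b unfolding homogeneous_iff_avoids[OF f(1)] by force
    then show "card X \<le> max_homogeneous (s + 1) {1..n} f"
      by (intro card_le_max_homogeneous) auto
  qed (use used in auto)
  finally show ?thesis
    using fmin by simp
qed

section \<open>Erdos-Hajnal lower bound\<close>

lemma disjoint_subsets_of_card:
  assumes "finite J" "finite X" "card X \<ge> card J * M"
  shows "\<exists>W. (\<forall>j\<in>J. W j \<subseteq> X \<and> card (W j) = M) \<and> disjoint_family_on W J"
  using assms
proof (induction J arbitrary: X rule: finite_induct)
  case empty
  show ?case
    by (simp add: disjoint_family_on_def)
next
  case (insert j J)
  have ge: "card X \<ge> card J * M + M"
    using insert.prems insert.hyps by simp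
  then obtain Y where Y: "Y \<subseteq> X" "card Y = M"
    using obtain_subset_with_card_n[of M X] by auto
  have "card (X - Y) \<ge> card J * M"
    using Y ge insert.prems(1) by (simp add: card_Diff_subset finite_subset)
  then obtain W where W: "\<And>i. i \<in> J \<Longrightarrow> W i \<subseteq> X - Y" "\<And>i. i \<in> J \<Longrightarrow> card (W i) = M"
    "disjoint_family_on W J"
    using insert.IH[of "X - Y"] insert.prems(1) by auto
  have "disjoint_family_on (W(j := Y)) (insert j J)"
    unfolding disjoint_family_on_def
  proof (intro ballI impI)
    fix i l assume "i \<in> insert j J" "l \<in> insert j J" "i \<noteq> l"
    then show "(W(j := Y)) i \<inter> (W(j := Y)) l = {}"
      using W(1)[of i] W(1)[of l] disjoint_family_onD[OF W(3), of i l] by (auto split: if_splits)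
  qed
  moreover have "\<forall>i\<in>insert j J. (W(j := Y)) i \<subseteq> X \<and> card ((W(j := Y)) i) = M"
    using W(1,2) Y by auto
  ultimately show ?case
    by (intro exI[of _ "W(j := Y)"] conjI)
qed

text \<open>The vertices of \<open>J\<close> are embedded one at a time, \<open>W j\<close> being
  the current candidates for the image of \<open>j\<close>. Each choice costs every remaining
  candidate set a factor of at most \<open>q\<close>, hence \<open>q ^ card J\<close>; the factor
  \<open>k * m\<close> leaves room to avoid fewer than \<open>k\<close> bad sets of at most
  \<open>m\<close> vertices each.\<close>

lemma greedy_embedding:
  fixes f :: "'a set \<Rightarrow> nat" and c :: "nat set \<Rightarrow> nat"
  assumes no_sparse: "\<And>A B b. A \<subseteq> X \<Longrightarrow> B \<subseteq> X \<Longrightarrow> A \<inter> B = {} \<Longrightarrow> card A \<ge> m \<Longrightarrow> card B \<ge> m \<Longrightarrow>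
      b \<in> c ` nsets I 2 \<Longrightarrow> \<exists>v\<in>A. card B \<le> q * card {w \<in> B. f {v, w} = b}"
    and "finite X" "m \<ge> 1" "q \<ge> 1"
    and "finite J" "J \<subseteq> I" "card J \<le> k"
    and "\<And>j. j \<in> J \<Longrightarrow> W j \<subseteq> X" "disjoint_family_on W J"
    and "\<And>j. j \<in> J \<Longrightarrow> card (W j) \<ge> k * m * q ^ card J"
  shows "\<exists>\<psi>. (\<forall>j\<in>J. \<psi> j \<in> W j) \<and> (\<forall>i\<in>J. \<forall>j\<in>J. i \<noteq> j \<longrightarrow> f {\<psi> i, \<psi> j} = c {i, j})"
  using assms(5-)
proof (induction J arbitrary: W rule: finite_induct)
  case empty
  then show ?case by simp
next
  case (insert i J)
  have card_J: "card J < k"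
    using insert.prems(2) insert.hyps by simp
  have big: "k * m \<le> card (W j)" if "j \<in> insert i J" for j
  proof -
    have "k * m * 1 \<le> k * m * q ^ card (insert i J)"
      using \<open>q \<ge> 1\<close> by (intro mult_left_mono) auto
    then show ?thesis
      using insert.prems(5)[OF that] by linarith
  qed
  \<comment> \<open>\<open>bad j\<close> holds the candidates for the image of \<open>i\<close> that would shrink \<open>W j\<close> by more than a factor \<open>q\<close>.\<close>
  define bad where "bad j = {v \<in> W i. q * card {w \<in> W j. f {v, w} = c {i, j}} < card (W j)}" for j
  have card_bad: "card (bad j) \<le> m" if j: "j \<in> J" for j
  proof (rule ccontr)
    assume "\<not> card (bad j) \<le> m"
    moreover have "1 * m \<le> k * m"
      using card_J by (intro mult_right_mono) linarith+
    then have "m \<le> card (W j)"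
      using big[OF insertI2[OF j]] by linarith
    moreover have "bad j \<subseteq> X" "W j \<subseteq> X"
      using insert.prems(3) j by (auto simp: bad_def)
    moreover have "bad j \<inter> W j = {}"
      using insert.prems(4) insert.hyps j
      by (fastforce simp: bad_def disjoint_family_on_def)
    moreover have "c {i, j} \<in> c ` nsets I 2"
      using insert.prems(1) insert.hyps j by (intro imageI pair_in_nsets) auto
    ultimately obtain v where "v \<in> bad j" "card (W j) \<le> q * card {w \<in> W j. f {v, w} = c {i, j}}"
      using no_sparse[of "bad j" "W j" "c {i, j}"] by auto
    then show False
      by (auto simp: bad_def)
  qed
  have "card (\<Union>j\<in>J. bad j) \<le> (\<Sum>j\<in>J. card (bad j))"
    using insert.hyps by (intro card_UN_le)
  also have "\<dots> \<le> (\<Sum>j\<in>J. m)"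
    using card_bad by (intro sum_mono)
  also have "\<dots> < k * m"
    using card_J \<open>m \<ge> 1\<close> by simp
  also have "\<dots> \<le> card (W i)"
    by (rule big) simp
  finally have "\<not> W i \<subseteq> (\<Union>j\<in>J. bad j)"
    using card_mono[of "\<Union>j\<in>J. bad j" "W i"] insert.hyps(1) insert.prems(3) \<open>finite X\<close>
    by (metis (no_types, lifting) bad_def finite_UN_I finite_subset insertI1 mem_Collect_eq
        not_le subsetI)
  then obtain v where v: "v \<in> W i" and v_good: "\<And>j. j \<in> J \<Longrightarrow> v \<notin> bad j"
    by blast
  define W' where "W' j = {w \<in> W j. f {v, w} = c {i, j}}" for j
  have card_W': "card (W' j) \<ge> k * m * q ^ card J" if j: "j \<in> J" for j
  proof -
    \<comment> \<open>One factor \<open>q\<close> of the size hypothesis pays for restricting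
      \<open>W j\<close> to the neighbours of \<open>v\<close> in the right colour.\<close>
    have "q * (k * m * q ^ card J) \<le> card (W j)"
      using insert.prems(5)[of j] insert.hyps j by (simp add: mult_ac)
    also have "\<dots> \<le> q * card (W' j)"
      using v_good[OF j] v by (simp add: bad_def W'_def)
    finally show ?thesis
      using \<open>q \<ge> 1\<close> by simp
  qed
  have "disjoint_family_on W' J"
    using insert.prems(4) unfolding disjoint_family_on_def W'_def by blast
  moreover have "W' j \<subseteq> X" if "j \<in> J" for j
    using insert.prems(3)[of j] that by (auto simp: W'_def)
  moreover have "J \<subseteq> I" "card J \<le> k"
    using insert.prems(1) card_J by auto
  ultimately have "\<exists>\<psi>. (\<forall>j\<in>J. \<psi> j \<in> W' j) \<and>
      (\<forall>i\<in>J. \<forall>j\<in>J. i \<noteq> j \<longrightarrow> f {\<psi> i, \<psi> j} = c {i, j})"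
    using card_W' by (intro insert.IH)
  then obtain \<psi> where \<psi>: "\<forall>j\<in>J. \<psi> j \<in> W' j"
    "\<forall>i\<in>J. \<forall>j\<in>J. i \<noteq> j \<longrightarrow> f {\<psi> i, \<psi> j} = c {i, j}"
    by (elim exE conjE)
  show ?case
  proof (intro exI[of _ "\<psi>(i := v)"] conjI ballI impI)
    fix j assume "j \<in> insert i J"
    then show "(\<psi>(i := v)) j \<in> W j"
      using \<psi>(1) v by (auto simp: W'_def)
  next
    fix j l assume "j \<in> insert i J" "l \<in> insert i J" "j \<noteq> l"
    then show "f {(\<psi>(i := v)) j, (\<psi>(i := v)) l} = c {j, l}"
      using \<psi> by (auto simp: W'_def insert_commute)
  qed
qed

text \<open>If no pair were sparse in a colour of \<open>c\<close>, greedy embedding into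
  \<open>k\<close> disjoint blocks of \<open>k * m * q ^ k\<close> vertices of \<open>X\<close>
  would produce a copy of \<open>c\<close>.\<close>

lemma copy_free_sparse_pair:
  assumes "copy_free k c V f" "X \<subseteq> V" "finite X" "m \<ge> 1" "q \<ge> 1"
    and "card X \<ge> k * (k * m * q ^ k)"
  shows "\<exists>A B b. A \<subseteq> X \<and> B \<subseteq> X \<and> A \<inter> B = {} \<and> card A \<ge> m \<and> card B \<ge> m \<and>
    b \<in> c ` nsets {1..k} 2 \<and> (\<forall>v\<in>A. q * card {w \<in> B. f {v, w} = b} < card B)"
proof (rule ccontr)
  assume no: "\<not> ?thesis"
  have no_sparse: "\<exists>v\<in>A. card B \<le> q * card {w \<in> B. f {v, w} = b}"
    if "A \<subseteq> X" "B \<subseteq> X" "A \<inter> B = {}" "card A \<ge> m" "card B \<ge> m" "b \<in> c ` nsets {1..k} 2" for A B b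
    using no that by (meson not_le)
  have "\<exists>W. (\<forall>j\<in>{1..k}. W j \<subseteq> X \<and> card (W j) = k * m * q ^ k) \<and> disjoint_family_on W {1..k}"
    using assms(3,6) by (intro disjoint_subsets_of_card) simp_all
  then obtain W where W: "\<forall>j\<in>{1..k}. W j \<subseteq> X \<and> card (W j) = k * m * q ^ k"
    "disjoint_family_on W {1..k}"
    by (elim exE conjE)
  have "\<exists>\<psi>. (\<forall>j\<in>{1..k}. \<psi> j \<in> W j) \<and>
      (\<forall>i\<in>{1..k}. \<forall>j\<in>{1..k}. i \<noteq> j \<longrightarrow> f {\<psi> i, \<psi> j} = c {i, j})"
    by (rule greedy_embedding[where X = X and m = m and q = q and I = "{1..k}" and k = k])
      (use no_sparse assms(3-5) W in \<open>simp_all\<close>)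
  then obtain \<psi> where \<psi>: "\<forall>j\<in>{1..k}. \<psi> j \<in> W j"
    "\<forall>i\<in>{1..k}. \<forall>j\<in>{1..k}. i \<noteq> j \<longrightarrow> f {\<psi> i, \<psi> j} = c {i, j}"
    by (elim exE conjE)
  have inj: "inj_on \<psi> {1..k}"
  proof (intro inj_onI, rule ccontr)
    fix i j assume ij: "i \<in> {1..k}" "j \<in> {1..k}" "\<psi> i = \<psi> j" "i \<noteq> j"
    then have "\<psi> i \<in> W i \<inter> W j"
      using \<psi>(1) by (metis IntI)
    then show False
      using disjoint_family_onD[OF W(2) ij(1,2,4)] by simp
  qed
  define U where "U = \<psi> ` {1..k}"
  \<comment> \<open>The embedding maps \<open>{1..k}\<close> into \<open>X\<close>, whereas a copy
    asks for a bijection in the other direction.\<close>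
  define \<phi> where "\<phi> = the_inv_into {1..k} \<psi>"
  have \<phi>: "\<phi> (\<psi> i) = i" if "i \<in> {1..k}" for i
    unfolding \<phi>_def using inj that by (rule the_inv_into_f_f)
  have bij: "bij_betw \<phi> U {1..k}"
    unfolding U_def \<phi>_def using inj by (intro bij_betw_the_inv_into) (simp add: bij_betw_def)
  have "f {x, y} = c {\<phi> x, \<phi> y}" if xy: "x \<in> U" "y \<in> U" "x \<noteq> y" for x y
  proof -
    obtain i j where "x = \<psi> i" "y = \<psi> j" "i \<in> {1..k}" "j \<in> {1..k}"
      using xy(1,2) unfolding U_def by (elim imageE)
    then show ?thesis
      using \<psi>(2) \<phi> xy(3) by metis
  qed
  moreover have "card U = k"
    using inj by (simp add: U_def card_image)
  moreover have "U \<subseteq> V"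
  proof
    fix x assume "x \<in> U"
    then obtain i where "i \<in> {1..k}" "x = \<psi> i"
      unfolding U_def by (elim imageE)
    then show "x \<in> V"
      using \<psi>(1) W(1) assms(2) by (meson subsetD)
  qed
  ultimately have "is_copy k c V f U"
    unfolding is_copy_def using bij by blast
  then show False
    using assms(1) by (auto simp: copy_free_def)
qed

text \<open>\<open>S b\<close> is a \<open>b\<close>-free subset of \<open>T\<close>, and the
  product of their sizes doubles when two parts are merged. The bound on \<open>card T\<close>
  limits how much of the other part has to be deleted, and \<open>N\<close> makes
  \<open>N ^ Suc i\<close> exactly the size that guarantees a sparse pair with parts of
  \<open>2 * N ^ i\<close> vertices.\<close>

lemma erdos_hajnal_recursion:
  assumes "copy_free k c V f" "finite V" "k \<ge> 1" "c ` nsets {1..k} 2 \<subseteq> {1..s}"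
    and N: "N = 2 * k * k * (2 * 2 ^ r) ^ k"
  shows "i \<le> r \<Longrightarrow> X \<subseteq> V \<Longrightarrow> card X \<ge> N ^ i \<Longrightarrow>
    \<exists>T S. T \<subseteq> X \<and> card T \<le> 2 ^ i \<and> (\<forall>b\<in>{1..s}. S b \<subseteq> T \<and> avoids f b (S b)) \<and>
      2 ^ i \<le> (\<Prod>b\<in>{1..s}. card (S b))"
proof (induction i arbitrary: X)
  case 0
  then obtain x where "x \<in> X"
    by (metis card.empty ex_in_conv not_one_le_zero power_0)
  then show ?case
    by (intro exI[of _ "{x}"] exI[of _ "\<lambda>_. {x}"]) (auto simp: avoids_def)
next
  case (Suc i)
  define q where "q = 2 * (2::nat) ^ r"
  have "k * (k * (2 * N ^ i) * q ^ k) = N ^ Suc i"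
    by (simp add: N q_def)
  then have card_X: "k * (k * (2 * N ^ i) * q ^ k) \<le> card X"
    using Suc.prems(3) by (simp only:)
  have "N ^ i \<ge> 1" "q \<ge> 1"
    using \<open>k \<ge> 1\<close> by (auto simp: N q_def)
  then have "2 * N ^ i \<ge> 1"
    by linarith
  from copy_free_sparse_pair[OF assms(1) Suc.prems(2) finite_subset[OF Suc.prems(2) assms(2)]
      this \<open>q \<ge> 1\<close> card_X]
  obtain A B b where "A \<subseteq> X \<and> B \<subseteq> X \<and> A \<inter> B = {} \<and> card A \<ge> 2 * N ^ i \<and> card B \<ge> 2 * N ^ i \<and>
      b \<in> c ` nsets {1..k} 2 \<and> (\<forall>v\<in>A. q * card {w \<in> B. f {v, w} = b} < card B)"
    by (elim exE) (rule that)
  then have AB: "A \<subseteq> X" "B \<subseteq> X" "A \<inter> B = {}" "card A \<ge> 2 * N ^ i" "card B \<ge> 2 * N ^ i"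
    and b: "b \<in> c ` nsets {1..k} 2"
    and sparse: "\<And>v. v \<in> A \<Longrightarrow> q * card {w \<in> B. f {v, w} = b} < card B"
    by simp_all
  have fin: "finite A" "finite B"
    using AB(1,2) Suc.prems(2) assms(2) by (auto intro: finite_subset)
  obtain T1 S1 where T1: "T1 \<subseteq> A" "card T1 \<le> 2 ^ i" "\<And>b. b \<in> {1..s} \<Longrightarrow> S1 b \<subseteq> T1"
    "\<And>b. b \<in> {1..s} \<Longrightarrow> avoids f b (S1 b)" "2 ^ i \<le> (\<Prod>b\<in>{1..s}. card (S1 b))"
  proof -
    have "i \<le> r" "A \<subseteq> V" "card A \<ge> N ^ i"
      using Suc.prems AB by auto
    from Suc.IH[OF this] that show thesis
      by metis
  qed
  \<comment> \<open>Deleting all \<open>b\<close>-neighbours of \<open>T1\<close> costs at most half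
    of \<open>B\<close>: each of the at most \<open>2 ^ i\<close> vertices has fewer than
    \<open>card B / q\<close> of them, and \<open>q \<ge> 2 * 2 ^ i\<close> because
    \<open>i < r\<close>.\<close>
  define bad where "bad = (\<Union>v\<in>T1. {w \<in> B. f {v, w} = b})"
  have "finite T1"
    using T1(1) fin finite_subset by blast
  have "q * card bad \<le> q * (\<Sum>v\<in>T1. card {w \<in> B. f {v, w} = b})"
    unfolding bad_def using \<open>finite T1\<close> by (intro mult_left_mono card_UN_le) auto
  also have "\<dots> \<le> (\<Sum>v\<in>T1. card B)"
    unfolding sum_distrib_left using sparse T1(1) by (intro sum_mono) (auto intro: less_imp_le)
  also have "\<dots> \<le> 2 ^ i * card B"
    using T1(2) by simp
  finally have "q * card bad \<le> 2 ^ i * card B" .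
  moreover have "2 * 2 ^ i * card bad \<le> q * card bad"
    using Suc.prems(1) unfolding q_def by (intro mult_right_mono mult_left_mono power_increasing) auto
  ultimately have "2 ^ i * (2 * card bad) \<le> 2 ^ i * card B"
    by linarith
  then have "2 * card bad \<le> card B"
    by simp
  moreover have "bad \<subseteq> B"
    by (auto simp: bad_def)
  ultimately have "card (B - bad) \<ge> N ^ i"
    using AB(5) fin by (simp add: card_Diff_subset finite_subset)
  then obtain T2 S2 where T2: "T2 \<subseteq> B - bad" "card T2 \<le> 2 ^ i" "\<And>b. b \<in> {1..s} \<Longrightarrow> S2 b \<subseteq> T2"
    "\<And>b. b \<in> {1..s} \<Longrightarrow> avoids f b (S2 b)" "2 ^ i \<le> (\<Prod>b\<in>{1..s}. card (S2 b))"
  proof -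
    assume "card (B - bad) \<ge> N ^ i"
    moreover have "i \<le> r" "B - bad \<subseteq> V"
      using Suc.prems AB by auto
    ultimately show thesis
      using Suc.IH[of "B - bad"] that by metis
  qed
  \<comment> \<open>No cross edge between the two parts has colour \<open>b\<close>, so the sets for \<open>b\<close> can be united; this makes
    the products over all colours add up.\<close>
  define S where "S = (\<lambda>b'. if b' = b then S1 b \<union> S2 b
     else if card (S1 b') \<le> card (S2 b') then S2 b' else S1 b')"
  have "finite T2"
    using T2(1) fin finite_subset by blast
  have bs: "b \<in> {1..s}"
    using b assms(4) by blast
  have cross: "f {x, y} \<noteq> b" if "x \<in> T1" "y \<in> T2" for x y
    using that T2(1) by (auto simp: bad_def)
  have "avoids f b (S1 b \<union> S2 b)"
    unfolding avoids_def
  proof (intro ballI impI)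
    fix x y assume "x \<in> S1 b \<union> S2 b" "y \<in> S1 b \<union> S2 b" "x \<noteq> y"
    then show "f {x, y} \<noteq> b"
      using T1(3,4)[OF bs] T2(3,4)[OF bs] cross[of x y] cross[of y x]
      unfolding avoids_def by (auto simp: insert_commute)
  qed
  then have avoid: "S b' \<subseteq> T1 \<union> T2 \<and> avoids f b' (S b')" if "b' \<in> {1..s}" for b'
    using that T1(3,4)[of b'] T2(3,4)[of b'] by (auto simp: S_def)
  have "S1 b \<inter> S2 b = {}"
    using T1(1) T1(3)[OF bs] T2(1) T2(3)[OF bs] AB(3) by blast
  then have card_Sb: "card (S b) = card (S1 b) + card (S2 b)"
    using finite_subset[OF T1(3)[OF bs] \<open>finite T1\<close>] finite_subset[OF T2(3)[OF bs] \<open>finite T2\<close>]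
    by (simp add: S_def card_Un_disjoint)
  have "2 ^ Suc i \<le> (\<Prod>b\<in>{1..s}. card (S1 b)) + (\<Prod>b\<in>{1..s}. card (S2 b))"
    using T1(5) T2(5) by simp
  also have "\<dots> = card (S1 b) * (\<Prod>b\<in>{1..s}-{b}. card (S1 b))
      + card (S2 b) * (\<Prod>b\<in>{1..s}-{b}. card (S2 b))"
    using bs by (simp add: prod.remove[of _ b])
  \<comment> \<open>For colours other than \<open>b\<close>, \<open>S\<close> takes the larger of
    the two sets, so both products are bounded by a common one that factors out.\<close>
  also have "\<dots> \<le> card (S1 b) * (\<Prod>b\<in>{1..s}-{b}. card (S b))
      + card (S2 b) * (\<Prod>b\<in>{1..s}-{b}. card (S b))"
    by (intro add_mono mult_left_mono prod_mono) (auto simp: S_def)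
  also have "\<dots> = (\<Prod>b\<in>{1..s}. card (S b))"
    using bs by (simp add: prod.remove[of _ b] card_Sb add_mult_distrib)
  finally have "2 ^ Suc i \<le> (\<Prod>b\<in>{1..s}. card (S b))" .
  moreover have "card (T1 \<union> T2) \<le> 2 ^ Suc i"
    using card_Un_le[of T1 T2] T1(2) T2(2) by simp
  moreover have "T1 \<union> T2 \<subseteq> X"
    using T1(1) T2(1) AB by blast
  ultimately show ?case
    using avoid by (intro exI[of _ "T1 \<union> T2"] exI[of _ S]) simp
qed

text \<open>The recursion at \<open>i = r\<close> gives a product of \<open>s\<close> factors, each
  the size of a homogeneous set.\<close>

lemma erdos_hajnal_lower_bound:
  assumes "copy_free k c V f" "finite V" "k \<ge> 1" "c ` nsets {1..k} 2 \<subseteq> {1..s}"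
    and "f \<in> edge_colourings s V"
    and "card V \<ge> (2 * k * k * (2 * 2 ^ r) ^ k) ^ r"
  shows "2 ^ r \<le> max_homogeneous s V f ^ s"
proof -
  obtain T S where T: "T \<subseteq> V" "\<And>b. b \<in> {1..s} \<Longrightarrow> S b \<subseteq> T \<and> avoids f b (S b)"
    "2 ^ r \<le> (\<Prod>b\<in>{1..s}. card (S b))"
    using erdos_hajnal_recursion[OF assms(1-4) refl, of r r V] assms(6) by blast
  have "card (S b) \<le> max_homogeneous s V f" if "b \<in> {1..s}" for b
    using T(1) T(2)[OF that] that assms(2)
    by (intro card_le_max_homogeneous) (auto simp: homogeneous_iff_avoids[OF assms(5)])
  then have "(\<Prod>b\<in>{1..s}. card (S b)) \<le> (\<Prod>b\<in>{1..s}. max_homogeneous s V f)"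
    by (intro prod_mono) auto
  then show ?thesis
    using T(3) by simp
qed

section \<open>Turan bound and balanced splitting of a colour\<close>

text \<open>Peel off maximal \<open>a\<close>-free sets \<open>d\<close> times: after
  \<open>t\<close> rounds at least \<open>card X - t * h\<close> vertices remain, and each sends an
  \<open>a\<close>-edge into the set removed last. Summing over \<open>t\<close> gives the bound,
  written additively because subtraction on \<open>nat\<close> truncates.\<close>

lemma turan_lower_bound:
  assumes "finite X" "\<And>I. I \<subseteq> X \<Longrightarrow> avoids f a I \<Longrightarrow> card I \<le> h"
  shows "d * card X \<le> card {e \<in> nsets X 2. f e = a} + d * d * h"
  using assms
proof (induction d arbitrary: X)
  case 0
  then show ?case by simp
next
  case (Suc d)
  define E where "E Y = {e \<in> nsets Y 2. f e = a}" for Y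
  \<comment> \<open>Each vertex outside a maximal \<open>a\<close>-free set \<open>I\<close> sends an \<open>a\<close>-edge into \<open>I\<close>.\<close>
  define \<I> where "\<I> = {I. I \<subseteq> X \<and> avoids f a I}"
  have "finite \<I>" "\<I> \<noteq> {}"
    using Suc.prems(1) by (auto simp: \<I>_def avoids_def intro: exI[of _ "{}"])
  then obtain I where "I \<in> \<I>" and maximal: "\<And>J. J \<in> \<I> \<Longrightarrow> I \<subseteq> J \<Longrightarrow> I = J"
    using finite_has_maximal[of \<I>] by metis
  then have I: "I \<subseteq> X" "avoids f a I"
    by (auto simp: \<I>_def)
  have "\<exists>y\<in>I. f {x, y} = a" if x: "x \<in> X - I" for x
  proof (rule ccontr)
    assume "\<not> ?thesis"
    then have "avoids f a (insert x I)"
      using I(2) by (auto simp: avoids_def insert_commute)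
    then show False
      using maximal[of "insert x I"] I(1) x by (auto simp: \<I>_def)
  qed
  then obtain g where g: "\<And>x. x \<in> X - I \<Longrightarrow> g x \<in> I \<and> f {x, g x} = a"
    by metis
  \<comment> \<open>Each of these edges has exactly one endpoint outside \<open>I\<close>, so the
    map is injective and \<open>F\<close> contains no edge inside \<open>X - I\<close>.\<close>
  define F where "F = (\<lambda>x. {x, g x}) ` (X - I)"
  have "inj_on (\<lambda>x. {x, g x}) (X - I)"
    using g by (fastforce simp: inj_on_def doubleton_eq_iff)
  then have card_F: "card F = card X - card I"
    using I(1) Suc.prems(1) by (simp add: F_def card_image card_Diff_subset finite_subset)
  have finE: "finite (E Y)" if "Y \<subseteq> X" for Y
    using that Suc.prems(1) by (simp add: E_def finite_imp_finite_nsets finite_subset)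
  have "F \<inter> E (X - I) = {}"
    using g by (auto simp: F_def E_def nsets_def)
  then have "card F + card (E (X - I)) = card (F \<union> E (X - I))"
    using Suc.prems(1) finE[of "X - I"] by (subst card_Un_disjoint) (auto simp: F_def)
  also have "F \<union> E (X - I) \<subseteq> E X"
  proof -
    have "{x, g x} \<in> nsets X 2" if "x \<in> X - I" for x
      using g[OF that] that I(1) by (intro pair_in_nsets) auto
    moreover have "nsets (X - I) 2 \<subseteq> nsets X 2"
      by (intro nsets_mono) auto
    ultimately show ?thesis
      using g unfolding F_def E_def by blast
  qed
  then have "card (F \<union> E (X - I)) \<le> card (E X)"
    using finE by (intro card_mono) auto
  finally have 1: "card F + card (E (X - I)) \<le> card (E X)" .
  have 2: "d * card (X - I) \<le> card (E (X - I)) + d * d * h"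
    unfolding E_def using Suc.prems by (intro Suc.IH) auto
  have "card (X - I) = card F"
    using I(1) Suc.prems(1) by (simp add: card_F card_Diff_subset finite_subset)
  moreover have "card X \<le> card F + h"
    using Suc.prems(2)[OF I] card_F by simp
  then have "Suc d * card X \<le> Suc d * (card F + h)"
    by (rule mult_le_mono2)
  ultimately have "Suc d * card X \<le> card (E X) + (d * d + Suc d) * h"
    using 1 2 by (simp add: algebra_simps)
  also have "\<dots> \<le> card (E X) + Suc d * Suc d * h"
    by (intro add_left_mono mult_right_mono) auto
  finally show ?case
    by (simp add: E_def)
qed

text \<open>With denominators cleared: a uniformly random subset of \<open>E\<close> misses
  \<open>D\<close> or contains it with probability at most \<open>2 / 2 ^ card D\<close>. Such a
  subset is determined by its part outside \<open>D\<close> and by which of the two cases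
  holds.\<close>

lemma card_subsets_monochromatic:
  assumes "finite E" "D \<subseteq> E"
  shows "card {S \<in> Pow E. S \<inter> D = {} \<or> D \<subseteq> S} * 2 ^ card D \<le> 2 * 2 ^ card E"
proof -
  have "{S \<in> Pow E. S \<inter> D = {} \<or> D \<subseteq> S} \<subseteq> Pow (E - D) \<union> (\<union>) D ` Pow (E - D)"
  proof
    fix S assume S: "S \<in> {S \<in> Pow E. S \<inter> D = {} \<or> D \<subseteq> S}"
    show "S \<in> Pow (E - D) \<union> (\<union>) D ` Pow (E - D)"
    proof (cases "D \<subseteq> S")
      case True
      then have "S = D \<union> (S - D)" "S - D \<in> Pow (E - D)"
        using S by auto
      then show ?thesis by blast
    qed (use S in auto)
  qed
  then have "card {S \<in> Pow E. S \<inter> D = {} \<or> D \<subseteq> S} \<le> card (Pow (E - D) \<union> (\<union>) D ` Pow (E - D))"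
    using assms by (intro card_mono) auto
  also have "\<dots> \<le> card (Pow (E - D)) + card ((\<union>) D ` Pow (E - D))"
    by (rule card_Un_le)
  also have "\<dots> \<le> 2 * card (Pow (E - D))"
    using card_image_le[of "Pow (E - D)" "(\<union>) D"] assms by simp
  finally have "card {S \<in> Pow E. S \<inter> D = {} \<or> D \<subseteq> S} * 2 ^ card D \<le> 2 * 2 ^ card (E - D) * 2 ^ card D"
    using assms by (simp add: card_Pow)
  also have "\<dots> = 2 * 2 ^ (card (E - D) + card D)"
    by (simp add: power_add)
  also have "card (E - D) + card D = card E"
    using assms by (simp add: card_Diff_subset finite_subset card_mono)
  finally show ?thesis .
qed

text \<open>The union bound over random subsets \<open>S\<close> of the edges of colour \<open>a\<close>, written as a counting argument.\<close>

lemma exists_balanced_subset: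
  fixes f :: "'a set \<Rightarrow> nat"
  assumes V: "finite V" "V \<noteq> {}" and hp: "h \<ge> 1" "p \<ge> 1" "2 * card V \<le> 2 ^ p"
    and indep: "\<And>I. I \<subseteq> V \<Longrightarrow> avoids f a I \<Longrightarrow> card I \<le> h"
  defines "D \<equiv> \<lambda>X. {e \<in> nsets X 2. f e = a}"
  shows "\<exists>S\<subseteq>D V. \<forall>X\<in>nsets V (4 * h * p). S \<inter> D X \<noteq> {} \<and> \<not> D X \<subseteq> S"
proof (rule ccontr)
  assume contra: "\<not> ?thesis"
  define m where "m = 4 * h * p"
  define n where "n = card V"
  define bad where "bad X = {S \<in> Pow (D V). S \<inter> D X = {} \<or> D X \<subseteq> S}" for X
  have fin: "finite (D V)"
    using V(1) by (simp add: D_def finite_imp_finite_nsets)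
  have card_bad: "card (bad X) * 2 ^ (m * p) \<le> 2 * 2 ^ card (D V)" if X: "X \<in> nsets V m" for X
  proof -
    have XV: "X \<subseteq> V" "card X = m" "finite X"
      using X by (auto simp: nsets_def)
    \<comment> \<open>The Turan bound with \<open>d = 2 * p\<close>: as
      \<open>card X = 4 * h * p\<close>, it leaves
      \<open>8 * h * p * p - 4 * h * p * p = m * p\<close> edges of colour \<open>a\<close>.\<close>
    have "2 * p * card X \<le> card (D X) + 2 * p * (2 * p) * h"
      unfolding D_def using XV by (intro turan_lower_bound) (auto intro: indep)
    then have "m * p \<le> card (D X)"
      using XV by (simp add: m_def algebra_simps)
    then have "card (bad X) * 2 ^ (m * p) \<le> card (bad X) * 2 ^ card (D X)"
      by (intro mult_left_mono power_increasing) auto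
    also have "\<dots> \<le> 2 * 2 ^ card (D V)"
      unfolding bad_def using nsets_mono[OF XV(1), of 2]
      by (intro card_subsets_monochromatic fin) (auto simp: D_def)
    finally show ?thesis .
  qed
  have fin_sets: "finite (nsets V m)"
    using V(1) by (rule finite_imp_finite_nsets)
  have "Pow (D V) \<subseteq> (\<Union>X\<in>nsets V m. bad X)"
    using contra unfolding bad_def m_def by blast
  then have "card (Pow (D V)) \<le> card (\<Union>X\<in>nsets V m. bad X)"
    using fin fin_sets by (intro card_mono) (auto simp: bad_def)
  also have "\<dots> \<le> (\<Sum>X\<in>nsets V m. card (bad X))"
    using fin_sets by (rule card_UN_le)
  finally have "2 ^ card (D V) * 2 ^ (m * p) \<le> (\<Sum>X\<in>nsets V m. card (bad X)) * 2 ^ (m * p)"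
    using fin by (simp add: card_Pow)
  also have "\<dots> \<le> (\<Sum>X\<in>nsets V m. 2 * 2 ^ card (D V))"
    unfolding sum_distrib_right by (intro sum_mono card_bad)
  also have "\<dots> = 2 ^ card (D V) * (2 * (n choose m))"
    by (simp add: card_nsets n_def)
  finally have "2 ^ (m * p) \<le> 2 * (n choose m)"
    by simp
  also have "n choose m \<le> n ^ m"
    using binomial_le_pow[of m n] by (cases "m \<le> n") (auto simp: binomial_eq_0)
  finally have "2 ^ (m * p) \<le> 2 * n ^ m"
    by simp
  \<comment> \<open>The hypothesis \<open>2 * n \<le> 2 ^ p\<close> gains a factor
    \<open>2 ^ m\<close> over the union bound, which would force \<open>2 ^ m \<le> 2\<close>,
    although \<open>m \<ge> 4\<close>.\<close>
  moreover have "(2 * n) ^ m \<le> (2 ^ p) ^ m"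
    using hp by (intro power_mono) (auto simp: n_def)
  then have "2 ^ m * n ^ m \<le> 2 ^ (m * p)"
    by (simp add: power_mult_distrib mult.commute flip: power_mult)
  ultimately have "2 ^ m * n ^ m \<le> 2 * n ^ m"
    by linarith
  moreover have "n > 0"
    using V by (simp add: n_def card_gt_0_iff)
  ultimately have "2 ^ m \<le> (2::nat) ^ 1"
    by simp
  then have "m \<le> 1"
    by (simp only: power_increasing_iff)
  moreover have "1 * 1 \<le> h * p"
    using hp by (intro mult_le_mono) auto
  ultimately show False
    unfolding m_def by linarith
qed

section \<open>Upper bound for \<open>s + 1\<close> colours with a logarithmic factor\<close>

lemma min_homogeneous_pos:
  assumes "card (c ` nsets {1..k} 2) < s" "card (c ` nsets {1..k} 2) \<ge> 1" "n \<ge> 1"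
  shows "min_homogeneous s n k c \<ge> 1"
proof -
  obtain f where f: "min_homogeneous s n k c = max_homogeneous s {1..n} f"
    using min_homogeneous_attained[OF assms(1,2)] by metis
  have "card {1::nat} \<le> max_homogeneous s {1..n} f"
    using assms by (intro card_le_max_homogeneous) (auto simp: homogeneous_def)
  then show ?thesis
    using f by simp
qed

text \<open>Neither \<open>a\<close> nor \<open>s + 1\<close> is used by \<open>c\<close>, so every
  splitting of the \<open>a\<close>-edges stays \<open>c\<close>-free. Balance bounds the sets that
  miss \<open>a\<close> or \<open>s + 1\<close>; a set missing another colour already missed it
  under \<open>f\<close> and has at most \<open>h\<close> vertices.\<close>

lemma min_homogeneous_Suc_le:
  assumes "c \<in> edge_colourings s {1..k}"
    and used: "card (c ` nsets {1..k} 2) < s" "card (c ` nsets {1..k} 2) \<ge> 1"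
    and n: "n \<ge> 1" "2 * n \<le> 2 ^ p"
  shows "min_homogeneous (s + 1) n k c \<le> 4 * min_homogeneous s n k c * p"
proof -
  obtain a where a: "a \<in> {1..s}" "a \<notin> c ` nsets {1..k} 2"
    using unused_colour[OF used(1)] .
  obtain f where f: "f \<in> edge_colourings s {1..n}" "copy_free k c {1..n} f"
    and fmin: "min_homogeneous s n k c = max_homogeneous s {1..n} f"
    using min_homogeneous_attained[OF used] .
  define h where "h = max_homogeneous s {1..n} f"
  have h: "h \<ge> 1"
    using min_homogeneous_pos[OF used n(1)] fmin by (simp add: h_def)
  have p: "p \<ge> 1"
    using n by (cases p) auto
  have avoid_le: "card X \<le> h" if "X \<subseteq> {1..n}" "b \<in> {1..s}" "avoids f b X" for X b
    unfolding h_def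
  proof (rule card_le_max_homogeneous)
    show "homogeneous s {1..n} f X"
      unfolding homogeneous_iff_avoids[OF f(1)] using that by blast
  qed simp
  define D where "D X = {e \<in> nsets X 2. f e = a}" for X
  obtain S where S: "S \<subseteq> D {1..n}"
    and balanced: "\<And>X. X \<in> nsets {1..n} (4 * h * p) \<Longrightarrow> S \<inter> D X \<noteq> {} \<and> \<not> D X \<subseteq> S"
    using exists_balanced_subset[of "{1..n}" h p f a] n h p avoid_le[OF _ a(1)]
    unfolding D_def by auto
  define g where "g = (\<lambda>e. if e \<in> S then s + 1 else f e)"
  have g: "g \<in> edge_colourings (s + 1) {1..n}"
    using f(1) by (force simp: edge_colourings_def g_def Pi_iff)
  have "s + 1 \<notin> c ` nsets {1..k} 2"
    using assms(1) by (force simp: edge_colourings_def Pi_iff)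
  then have "copy_free k c {1..n} g"
    by (intro copy_free_recolour[OF f(2)]) (auto simp: g_def split: if_splits)
  then have "min_homogeneous (s + 1) n k c \<le> max_homogeneous (s + 1) {1..n} g"
    using used g by (intro min_homogeneous_le) auto
  also have "\<dots> \<le> 4 * h * p"
  proof (rule max_homogeneous_leI)
    fix X assume "homogeneous (s + 1) {1..n} g X"
    then obtain b where X: "X \<subseteq> {1..n}" and b: "b \<in> {1..s + 1}" "avoids g b X"
      using homogeneous_iff_avoids[OF g] by blast
    show "card X \<le> 4 * h * p"
    proof (cases "b = a \<or> b = s + 1")
      case True
      show ?thesis
      proof (rule ccontr)
        assume "\<not> ?thesis"
        \<comment> \<open>Balance concerns sets of exactly \<open>4 * h * p\<close> vertices, so a
          larger set is cut down first; \<open>Y\<close> then contains edges of both colours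
          \<open>a\<close> and \<open>s + 1\<close>.\<close>
        then obtain Y where Y: "Y \<subseteq> X" "card Y = 4 * h * p" "finite Y"
          using obtain_subset_with_card_n[of "4 * h * p" X] by auto
        then have "Y \<in> nsets {1..n} (4 * h * p)"
          using X by (auto simp: nsets_def)
        from balanced[OF this] obtain e e' where e: "e \<in> D Y" "e \<in> S" and e': "e' \<in> D Y" "e' \<notin> S"
          by blast
        have g_avoids: "g d \<noteq> b" if "d \<in> D Y" for d
        proof -
          have "d \<subseteq> Y" "card d = 2"
            using that by (auto simp: D_def nsets_def)
          then obtain x y where "d = {x, y}" "x \<noteq> y" "x \<in> Y" "y \<in> Y"
            by (auto simp: card_2_iff)
          then show ?thesis
            using b(2) Y(1) unfolding avoids_def by blast
        qed
        have "g e = s + 1" "g e' = a"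
          using e e' by (auto simp: g_def D_def)
        then show False
          using True g_avoids e(1) e'(1) by metis
      qed
    next
      case False
      have "avoids f b X"
        unfolding avoids_def
      proof (intro ballI impI)
        fix x y assume xy: "x \<in> X" "y \<in> X" "x \<noteq> y"
        then have "g {x, y} \<noteq> b"
          using b(2) by (auto simp: avoids_def)
        moreover have "{x, y} \<in> S \<Longrightarrow> f {x, y} = a"
          using S by (auto simp: D_def)
        ultimately show "f {x, y} \<noteq> b"
          using False by (auto simp: g_def split: if_splits)
      qed
      then have "card X \<le> h * 1"
        using avoid_le[of X b] X b False by simp
      also have "h * 1 \<le> h * (4 * p)"
        using p by (intro mult_le_mono2) simp
      finally show ?thesis
        by (simp add: mult_ac)
    qed
  qed auto
  finally show ?thesis
    using fmin by (simp add: h_def)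
qed

section \<open>Absorbing the logarithmic factor\<close>

text \<open>Writing \<open>h\<close> for the minimum, \<open>2 ^ r \<le> h ^ s\<close> gives
  \<open>h powr \<xi> \<ge> 2 powr (r * \<delta>)\<close> with \<open>\<delta> = \<xi> / s\<close>;
  with \<open>r\<close> of order \<open>ln n powr (1/3)\<close> this outgrows
  \<open>log 2 n\<close>.\<close>

lemma min_homogeneous_superpolylogarithmic:
  fixes \<xi> :: real
  assumes "c \<in> edge_colourings s {1..k}"
    and used: "card (c ` nsets {1..k} 2) < s" "card (c ` nsets {1..k} 2) \<ge> 1"
    and "\<xi> > 0"
  shows "eventually (\<lambda>n. 4 * (log 2 (2 * real n) + 1) \<le> real (min_homogeneous s n k c) powr \<xi>) at_top"
proof -
  define \<delta> where "\<delta> = \<xi> / real s"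
  have s: "s > 0"
    using used by simp
  have \<delta>: "\<delta> > 0"
    using s \<open>\<xi> > 0\<close> by (simp add: \<delta>_def)
  have "nsets {1..k} 2 \<noteq> {}"
    using used(2) by force
  then have k: "k > 0"
    by (cases k) (auto simp: nsets_eq_empty_iff)
  have image: "c ` nsets {1..k} 2 \<subseteq> {1..s}"
    using assms(1) by (auto simp: edge_colourings_def Pi_iff)
  define K where "K = ln (2 * real k * real k)"
  define \<kappa> where "\<kappa> = real k"
  have "K \<ge> 0"
  proof -
    have "1 \<le> 2 * k * k"
      using k by simp
    then have "1 \<le> real (2 * k * k)"
      by linarith
    then show ?thesis
      by (simp add: K_def)
  qed
  have "\<kappa> > 0"
    using k by (simp add: \<kappa>_def)
  \<comment> \<open>The left side bounds the logarithm of the Erdos-Hajnal threshold, with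
    \<open>r\<close> replaced by its upper bound \<open>ln n powr (1/3)\<close>; it is of order
    \<open>ln n powr (2/3)\<close>. The next estimate uses the lower bound
    \<open>ln n powr (1/3) - 1\<close> for \<open>r\<close>.\<close>
  have "eventually (\<lambda>n. ln (real n) powr (1/3) * (K + \<kappa> * (ln (real n) powr (1/3) + 1) * ln 2)
      \<le> ln (real n)) at_top"
    using \<open>\<kappa> > 0\<close> by real_asymp
  moreover have "eventually (\<lambda>n. 4 * (log 2 (2 * real n) + 1)
      \<le> 2 powr ((ln (real n) powr (1/3) - 1) * \<delta>)) at_top"
    using \<delta> by real_asymp
  ultimately show ?thesis
    using eventually_ge_at_top[of "1::nat"]
  proof eventually_elim
    case (elim n)
    define x where "x = ln (real n) powr (1/3)"
    \<comment> \<open>Any exponent strictly between 0 and 1/2 works in \<open>x\<close>: the threshold of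
      the Erdos-Hajnal bound is \<open>exp (O(r\<^sup>2))\<close>, while the bound obtained is exponential in \<open>r\<close>.\<close>
    define r where "r = nat \<lfloor>x\<rfloor>"
    have "x \<ge> 0"
      by (simp add: x_def)
    then have r: "real r \<le> x" "x - 1 \<le> real r"
      unfolding r_def by linarith+
    have "real (2 * k * k * (2 * 2 ^ r) ^ k) = exp K * 2 powr (\<kappa> * (real r + 1))"
      using k by (simp add: K_def \<kappa>_def powr_mult_base flip: powr_realpow power_Suc)
        (simp add: powr_powr mult_ac add_ac)
    also have "\<dots> = exp (K + \<kappa> * (real r + 1) * ln 2)"
      by (simp add: powr_def exp_add)
    finally have "real ((2 * k * k * (2 * 2 ^ r) ^ k) ^ r) = exp (real r * (K + \<kappa> * (real r + 1) * ln 2))"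
      by (simp only: of_nat_power exp_of_nat_mult)
    also have "\<dots> \<le> exp (x * (K + \<kappa> * (x + 1) * ln 2))"
      using r \<open>x \<ge> 0\<close> \<open>K \<ge> 0\<close> \<open>\<kappa> > 0\<close>
      by (intro exp_mono mult_mono add_mono order_refl) auto
    also have "\<dots> \<le> exp (ln (real n))"
      using elim(1) by (simp add: x_def)
    also have "\<dots> = real n"
      using elim(3) by simp
    finally have large: "(2 * k * k * (2 * 2 ^ r) ^ k) ^ r \<le> n"
      by (simp only: of_nat_le_iff)
    define h where "h = min_homogeneous s n k c"
    obtain f where f: "f \<in> edge_colourings s {1..n}" "copy_free k c {1..n} f"
      and "h = max_homogeneous s {1..n} f"
      unfolding h_def using min_homogeneous_attained[OF used] by metis
    then have "2 ^ r \<le> h ^ s"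
      using erdos_hajnal_lower_bound[OF f(2) _ _ image f(1)] k large by simp
    then have "real (2 ^ r) \<le> real (h ^ s)"
      by (simp only: of_nat_le_iff)
    moreover have "h \<ge> 1"
      unfolding h_def using min_homogeneous_pos[OF used elim(3)] .
    ultimately have le: "2 powr real r \<le> real h powr real s"
      by (simp add: powr_realpow)
    have "4 * (log 2 (2 * real n) + 1) \<le> 2 powr ((x - 1) * \<delta>)"
      using elim(2) by (simp add: x_def)
    also have "\<dots> \<le> 2 powr (real r * \<delta>)"
      using r \<delta> by simp
    also have "\<dots> = (2 powr real r) powr \<delta>"
      by (simp add: powr_powr)
    also have "\<dots> \<le> (real h powr real s) powr \<delta>"
      using le \<delta> by (intro powr_mono2) auto
    also have "\<dots> = real h powr \<xi>"
      using s by (simp add: powr_powr \<delta>_def)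
    finally show ?case
      by (simp add: h_def)
  qed
qed

lemma min_homogeneous_Suc_le_powr:
  fixes \<xi> :: real
  assumes "c \<in> edge_colourings s {1..k}"
    and used: "card (c ` nsets {1..k} 2) < s" "card (c ` nsets {1..k} 2) \<ge> 1"
    and "\<xi> > 0"
  shows "\<exists>n\<^sub>0. \<forall>n\<ge>n\<^sub>0. real (min_homogeneous (s + 1) n k c)
    \<le> real (min_homogeneous s n k c) powr (1 + \<xi>)"
proof -
  have "eventually (\<lambda>n. real (min_homogeneous (s + 1) n k c)
      \<le> real (min_homogeneous s n k c) powr (1 + \<xi>)) at_top"
    using min_homogeneous_superpolylogarithmic[OF assms] eventually_ge_at_top[of 1]
  proof eventually_elim
    case (elim n)
    define h where "h = min_homogeneous s n k c"
    \<comment> \<open>The least exponent with \<open>2 * n \<le> 2 ^ p\<close>; rounding up costs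
      the \<open>+ 1\<close> in the growth estimate.\<close>
    define p where "p = nat \<lceil>log 2 (2 * real n)\<rceil>"
    have "log 2 (2 * real n) \<ge> 0"
      using elim(2) by simp
    then have p: "log 2 (2 * real n) \<le> real p" "real p \<le> log 2 (2 * real n) + 1"
      unfolding p_def by linarith+
    have "2 * real n \<le> 2 powr real p"
      using p(1) elim(2) by (simp add: log_le_iff)
    also have "\<dots> = real (2 ^ p)"
      by (simp add: powr_realpow)
    finally have "2 * n \<le> 2 ^ p"
      by linarith
    then have "min_homogeneous (s + 1) n k c \<le> 4 * h * p"
      unfolding h_def by (intro min_homogeneous_Suc_le assms elim(2))
    then have "real (min_homogeneous (s + 1) n k c) \<le> real (4 * h * p)"
      by (simp only: of_nat_le_iff)
    also have "\<dots> = real h * (4 * real p)"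
      by simp
    also have "\<dots> \<le> real h * real h powr \<xi>"
      using p(2) elim(1) by (intro mult_left_mono) (auto simp: h_def)
    also have "\<dots> = real h powr (1 + \<xi>)"
      using min_homogeneous_pos[OF used elim(2)] by (simp add: h_def powr_add)
    finally show ?case
      by (simp add: h_def)
  qed
  then show ?thesis
    by (simp add: eventually_at_top_linorder)
qed

section \<open>Transfer of the EH-property\<close>

text \<open>One direction is monotonicity. For the other, \<open>\<xi> = 1\<close> suffices:
  bounding by a square halves \<open>\<epsilon>\<close> and replaces \<open>C\<close> by its square
  root.\<close>

lemma EH_property_Suc_iff:
  assumes "c \<in> edge_colourings s {1..k}"
    and used: "card (c ` nsets {1..k} 2) < s" "card (c ` nsets {1..k} 2) \<ge> 1"
  shows "EH_property s k c \<longleftrightarrow> EH_property (s + 1) k c"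
proof
  assume "EH_property s k c"
  then obtain \<epsilon> C :: real where "\<epsilon> > 0" "C > 0"
    and le: "\<And>n. n \<ge> 1 \<Longrightarrow> C * real n powr \<epsilon> \<le> real (min_homogeneous s n k c)"
    unfolding EH_property_def by blast
  moreover have "C * real n powr \<epsilon> \<le> real (min_homogeneous (s + 1) n k c)" if "n \<ge> 1" for n
    using le[OF that] min_homogeneous_Suc_ge[OF assms, of n] by linarith
  ultimately show "EH_property (s + 1) k c"
    unfolding EH_property_def by blast
next
  assume "EH_property (s + 1) k c"
  then obtain \<epsilon> C :: real where "\<epsilon> > 0" "C > 0"
    and le: "\<And>n. n \<ge> 1 \<Longrightarrow> C * real n powr \<epsilon> \<le> real (min_homogeneous (s + 1) n k c)"
    unfolding EH_property_def by blast
  obtain n\<^sub>0 where n\<^sub>0: "\<And>n. n \<ge> n\<^sub>0 \<Longrightarrow>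
      real (min_homogeneous (s + 1) n k c) \<le> real (min_homogeneous s n k c) powr (1 + 1)"
    using min_homogeneous_Suc_le_powr[OF assms, of 1] by auto
  \<comment> \<open>The second entry covers the finitely many \<open>n < n\<^sub>0\<close>: there it
    makes the left side at most 1, which is the size of a single vertex. Adding 1 keeps the base
    positive.\<close>
  define C' where "C' = min (sqrt C) (real (n\<^sub>0 + 1) powr (- (\<epsilon> / 2)))"
  have "C' > 0"
    using \<open>C > 0\<close> by (simp add: C'_def)
  have "C' * real n powr (\<epsilon> / 2) \<le> real (min_homogeneous s n k c)" if "n \<ge> 1" for n
  proof (cases "n \<ge> n\<^sub>0")
    case True
    define h where "h = real (min_homogeneous s n k c)"
    have "h \<ge> 1"
      using min_homogeneous_pos[OF used that] by (simp add: h_def)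
    have "(sqrt C * real n powr (\<epsilon> / 2))\<^sup>2 = C * real n powr \<epsilon>"
      using \<open>C > 0\<close> that by (simp add: power_mult_distrib powr_power)
    also have "\<dots> \<le> h powr (1 + 1)"
      unfolding h_def using le[OF that] n\<^sub>0[OF True] by (rule order_trans)
    also have "\<dots> = h\<^sup>2"
      using \<open>h \<ge> 1\<close> by simp
    finally have "sqrt C * real n powr (\<epsilon> / 2) \<le> h"
      by (rule power2_le_imp_le) (use \<open>h \<ge> 1\<close> in linarith)
    moreover have "C' * real n powr (\<epsilon> / 2) \<le> sqrt C * real n powr (\<epsilon> / 2)"
      by (intro mult_right_mono) (auto simp: C'_def)
    ultimately show ?thesis
      by (simp add: h_def)
  next
    case False
    have "C' * real n powr (\<epsilon> / 2) \<le> real (n\<^sub>0 + 1) powr (- (\<epsilon> / 2)) * real (n\<^sub>0 + 1) powr (\<epsilon> / 2)"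
      using False \<open>\<epsilon> > 0\<close> \<open>C' > 0\<close> by (intro mult_mono powr_mono2) (auto simp: C'_def)
    also have "\<dots> = 1"
      by (simp flip: powr_add)
    also have "1 \<le> real (min_homogeneous s n k c)"
      using min_homogeneous_pos[OF used that] by simp
    finally show ?thesis .
  qed
  then show "EH_property s k c"
    unfolding EH_property_def using \<open>\<epsilon> > 0\<close> \<open>C' > 0\<close>
    by (intro exI[of _ "\<epsilon> / 2"] exI[of _ C']) auto
qed

theorem theorem1:
  fixes s s' k :: nat and c :: "nat set \<Rightarrow> nat"
  assumes "s' \<ge> 1"
    and "c \<in> edge_colourings s {1..k}"
    and "card (c ` nsets {1..k} 2) = s'"
    and "s > s'"
  shows "(\<forall>n\<ge>1. min_homogeneous (s + 1) n k c \<ge> min_homogeneous s n k c) \<and>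
    (\<forall>\<xi>::real. \<xi> > 0 \<longrightarrow>
       (\<exists>n\<^sub>0. \<forall>n\<ge>n\<^sub>0. real (min_homogeneous (s + 1) n k c)
                       \<le> real (min_homogeneous s n k c) powr (1 + \<xi>))) \<and>
    (EH_property s k c \<longleftrightarrow> EH_property (s + 1) k c)"
proof -
  have used: "card (c ` nsets {1..k} 2) < s" "card (c ` nsets {1..k} 2) \<ge> 1"
    using assms by auto
  show ?thesis
    using min_homogeneous_Suc_ge[OF assms(2) used] min_homogeneous_Suc_le_powr[OF assms(2) used]
      EH_property_Suc_iff[OF assms(2) used] by blast
qed

end
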